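(* Let $(\Omega,\mathcal{F},P)$ be a probability space, let $\mathcal{X}\subseteq\mathbb{R}^d$ and $\mathcal{Y}\subseteq\mathbb{R}^m$ be Borel sets, and let $p\in(0,1)$. Let $D_C=(X_C,Y_C)$ and $D_T=(X_T,Y_T)$ be $\mathcal{X}\times\mathcal{Y}$-valued random variables on $\Omega$, and let $Z$ be a $\{0,1\}$-valued random variable on $\Omega$ with $P(Z=1)=p$ that is independent of the pair $(D_C,D_T)$. Set $D_E=(X_E,Y_E)=D_T Z+D_C(1-Z)$, and assume that $Y_E$ and $Z$ are conditionally independent given $X_E$. Let $\mathcal{D}_C,\mathcal{D}_T,\mathcal{D}_E$ denote the distributions (laws) of $D_C,D_T,D_E$. For a nonnegative random variable $W:\Omega\to\mathbb{R}_+$ with $\mathbb{E}[W]=1$, let $W\mathcal{D}_E$ be the probability distribution on $\mathcal{X}\times\mathcal{Y}$ given by $W\mathcal{D}_E(A)=\mathbb{E}[W\,I\{D_E\in A\}]$ for measurable $A\subseteq\mathcal{X}\times\mathcal{Y}$. Then the weights $$W_T=\frac{\mathbb{E}[Z\mid X_E]}{p}\quad\text{and}\quad W_C=\frac{1-\mathbb{E}[Z\mid X_E]}{1-p}$$ satisfy $$W_T\mathcal{D}_E=\mathcal{D}_T\quad\text{and}\quad W_C\mathcal{D}_E=\mathcal{D}_C$$ as probability distributions on $\mathcal{X}\times\mathcal{Y}$.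
   Context: Here $D_C$ and $D_T$ represent a control data point and a treatment data point (features and outcome), $Z$ is the random treatment assignment, and $D_E$ is the data point obtained in the experiment: $D_E=D_T$ on $\{Z=1\}$ and $D_E=D_C$ on $\{Z=0\}$. $I\{\cdot\}$ denotes the indicator function and $\mathbb{R}_+=[0,\infty)$. The conditional expectation $\mathbb{E}[Z\mid X_E]$ is taken in a version with values in $[0,1]$. *)

theory Defs
  imports "HOL-Probability.Probability"
begin

text \<open>
  A function \<open>g\<close> is a version of the conditional expectation of \<open>f\<close> given the
  sub-sigma-algebra \<open>F\<close>. The library constant \<^const>\<open>real_cond_exp\<close> is one fixed version,
  whose values are constrained only almost everywhere.
\<close>
definition cond_exp_version ::
    "'w measure \<Rightarrow> 'w measure \<Rightarrow> ('w \<Rightarrow> real) \<Rightarrow> ('w \<Rightarrow> real) \<Rightarrow> bool" where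
  "cond_exp_version M F f g \<longleftrightarrow>
     g \<in> borel_measurable F \<and> (AE \<omega> in M. g \<omega> = real_cond_exp M F f \<omega>)"

definition cond_indep_var ::
    "'w measure \<Rightarrow> 'w measure \<Rightarrow> 'a measure \<Rightarrow> ('w \<Rightarrow> 'a) \<Rightarrow> 'b measure \<Rightarrow> ('w \<Rightarrow> 'b) \<Rightarrow> bool" where
  "cond_indep_var M F N1 X1 N2 X2 \<longleftrightarrow>
     subalgebra M F \<and> X1 \<in> measurable M N1 \<and> X2 \<in> measurable M N2 \<and>
     (\<forall>A\<in>sets N1. \<forall>B\<in>sets N2. AE \<omega> in M.
        real_cond_exp M F (\<lambda>\<omega>. indicator A (X1 \<omega>) * indicator B (X2 \<omega>)) \<omega> =
        real_cond_exp M F (\<lambda>\<omega>. indicator A (X1 \<omega>)) \<omega> *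
        real_cond_exp M F (\<lambda>\<omega>. indicator B (X2 \<omega>)) \<omega>)"

text \<open>The sigma-algebra generated by a random variable with values in \<open>N\<close>.\<close>
abbreviation generated_by :: "'w measure \<Rightarrow> 'a measure \<Rightarrow> ('w \<Rightarrow> 'a) \<Rightarrow> 'w measure" where
  "generated_by M N X \<equiv> vimage_algebra (space M) X N"

definition is_weight :: "'w measure \<Rightarrow> ('w \<Rightarrow> real) \<Rightarrow> bool" where
  "is_weight M W \<longleftrightarrow>
     W \<in> borel_measurable M \<and> (\<forall>\<omega>\<in>space M. 0 \<le> W \<omega>) \<and> integral\<^sup>L M W = 1"

definition weighted_law ::
    "'w measure \<Rightarrow> 'a measure \<Rightarrow> ('w \<Rightarrow> real) \<Rightarrow> ('w \<Rightarrow> 'a) \<Rightarrow> 'a measure" where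
  "weighted_law M N W D =
     measure_of (space N) (sets N) (\<lambda>A. ennreal (\<integral>\<omega>. W \<omega> * indicator A (D \<omega>) \<partial>M))"

text \<open>
  For weights the set function in \<^const>\<open>weighted_law\<close> is countably additive, so
  \<^const>\<open>measure_of\<close> does not fall back to the zero measure.
\<close>
lemma emeasure_weighted_law:
  assumes W: "is_weight M W" and D: "D \<in> measurable M N" and A: "A \<in> sets N"
  shows "emeasure (weighted_law M N W D) A = ennreal (\<integral>\<omega>. W \<omega> * indicator A (D \<omega>) \<partial>M)"
proof -
  let ?\<mu> = "\<lambda>A. ennreal (\<integral>\<omega>. W \<omega> * indicator A (D \<omega>) \<partial>M)"
  let ?Q = "distr (density M (\<lambda>\<omega>. ennreal (W \<omega>))) N D"
  have Wm[measurable]: "W \<in> borel_measurable M" and W0: "\<And>\<omega>. \<omega> \<in> space M \<Longrightarrow> 0 \<le> W \<omega>"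
    and W1: "integral\<^sup>L M W = 1"
    using W by (auto simp: is_weight_def)
  note D[measurable]
  have int: "integrable M W"
    using W1 not_integrable_integral_eq by fastforce
  have eq: "emeasure ?Q B = ?\<mu> B" if B[measurable]: "B \<in> sets N" for B
  proof -
    have "emeasure ?Q B = (\<integral>\<^sup>+\<omega>. ennreal (W \<omega>) * indicator (D -` B \<inter> space M) \<omega> \<partial>M)"
      by (simp add: emeasure_distr emeasure_density)
    also have "\<dots> = (\<integral>\<^sup>+\<omega>. ennreal (W \<omega> * indicator B (D \<omega>)) \<partial>M)"
      by (intro nn_integral_cong) (auto simp: indicator_def)
    also have "\<dots> = ?\<mu> B"
    proof (rule nn_integral_eq_integral)
      show "integrable M (\<lambda>\<omega>. W \<omega> * indicator B (D \<omega>))"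
        by (rule Bochner_Integration.integrable_bound[OF int]) (auto simp: indicator_def)
      show "AE \<omega> in M. 0 \<le> W \<omega> * indicator B (D \<omega>)"
        using W0 by (auto simp: indicator_def)
    qed
    finally show ?thesis .
  qed
  have "weighted_law M N W D = measure_of (space N) (sets N) (emeasure ?Q)"
    unfolding weighted_law_def
    by (intro measure_of_eq) (simp_all add: eq sets.sets_into_space sets.space_closed sets.sigma_sets_eq)
  also have "\<dots> = ?Q"
    using measure_of_of_measure[of ?Q] by simp
  finally show ?thesis
    using eq[OF A] by simp
qed

end

theory Submission
  imports Defs
begin

text \<open>
  On the rectangles, which generate the product sigma-algebra,
  \<open>E[e 1\<^sub>A(X\<^sub>E) 1\<^sub>B(Y\<^sub>E)] = E[1\<^sub>A(X\<^sub>E) E[Z | X\<^sub>E] E[1\<^sub>B(Y\<^sub>E) | X\<^sub>E]]\<close>, and conditional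
  independence turns the right-hand side into \<open>E[Z 1\<^sub>A(X\<^sub>E) 1\<^sub>B(Y\<^sub>E)]\<close>. So \<open>e\<close> and \<open>Z\<close> weight
  the law of \<open>D\<^sub>E\<close> in the same way. Since \<open>D\<^sub>E = D\<^sub>T\<close> on \<open>{Z = 1}\<close> and \<open>Z\<close> is independent of
  \<open>D\<^sub>T\<close>, weighting by \<open>Z\<close> gives \<open>p\<close> times the law of \<open>D\<^sub>T\<close>. The control arm is the same
  argument for \<open>1 - Z\<close> and \<open>1 - e\<close>.
\<close>

text \<open>The factor \<open>indicator A \<omega> * e \<omega>\<close> is
  \<open>F\<close>-measurable, so the indicator of \<open>B\<close> can be replaced under the
  integral by its conditional expectation. Conditional independence merges the two conditional
  expectations into one, and integrating over \<open>A\<close> in \<open>F\<close> removes the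
  conditioning. The bounds on \<open>e\<close> and \<open>Z\<close> supply integrability.\<close>

lemma integral_cond_exp_version_cond_indep:
  fixes Z e :: "'w \<Rightarrow> real"
  assumes "prob_space M"
    and Z01: "\<forall>\<omega>\<in>space M. Z \<omega> \<in> {0, 1}"
    and ci: "cond_indep_var M F N Y borel Z"
    and e: "cond_exp_version M F Z e"
    and e01: "\<forall>\<omega>\<in>space M. e \<omega> \<in> {0..1}"
    and A: "A \<in> sets F" and B: "B \<in> sets N"
  shows "(\<integral>\<omega>. e \<omega> * (indicator A \<omega> * indicator B (Y \<omega>)) \<partial>M) =
         (\<integral>\<omega>. Z \<omega> * (indicator A \<omega> * indicator B (Y \<omega>)) \<partial>M)"
proof -
  interpret prob_space M by fact
  have sub: "subalgebra M F" and Y[measurable]: "Y \<in> measurable M N"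
    and Z[measurable]: "Z \<in> borel_measurable M"
    using ci by (auto simp: cond_indep_var_def)
  interpret finite_measure_subalgebra M F
    by unfold_locales (fact sub)
  have eF[measurable]: "e \<in> borel_measurable F"
    and eE: "AE \<omega> in M. e \<omega> = real_cond_exp M F Z \<omega>"
    using e by (auto simp: cond_exp_version_def)
  have eM[measurable]: "e \<in> borel_measurable M"
    using measurable_from_subalg[OF sub eF] .
  have AM[measurable]: "A \<in> sets M"
    using A sub by (auto simp: subalgebra_def)
  note A[measurable] B[measurable]
  let ?b = "\<lambda>\<omega>. indicator B (Y \<omega>) :: real"
  \<comment> \<open>Conditional independence speaks of events only; as \<open>Z\<close> takes the
    values 0 and 1, it is itself the indicator of the event \<open>Z \<omega> = 1\<close>.\<close>
  have Z1: "indicator {1} (Z \<omega>) = Z \<omega>" if "\<omega> \<in> space M" for \<omega>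
    using Z01 that by (auto simp: indicator_def)
  have c1: "AE \<omega> in M. real_cond_exp M F (\<lambda>\<omega>. ?b \<omega> * indicator {1} (Z \<omega>)) \<omega> =
      real_cond_exp M F ?b \<omega> * real_cond_exp M F (\<lambda>\<omega>. indicator {1} (Z \<omega>)) \<omega>"
    using ci B by (auto simp: cond_indep_var_def)
  have c2: "AE \<omega> in M. real_cond_exp M F (\<lambda>\<omega>. ?b \<omega> * indicator {1} (Z \<omega>)) \<omega> =
      real_cond_exp M F (\<lambda>\<omega>. ?b \<omega> * Z \<omega>) \<omega>"
    by (rule real_cond_exp_cong) (auto simp: Z1)
  have c3: "AE \<omega> in M. real_cond_exp M F (\<lambda>\<omega>. indicator {1} (Z \<omega>)) \<omega> = real_cond_exp M F Z \<omega>"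
    by (rule real_cond_exp_cong) (auto simp: Z1)
  have prod: "AE \<omega> in M. e \<omega> * real_cond_exp M F ?b \<omega> = real_cond_exp M F (\<lambda>\<omega>. ?b \<omega> * Z \<omega>) \<omega>"
    using c1 c2 c3 eE by eventually_elim simp
  have ib: "integrable M (\<lambda>\<omega>. (indicator A \<omega> * e \<omega>) * ?b \<omega>)"
    using e01 by (intro integrable_const_bound[of _ 1] AE_I2) (auto simp: indicator_def)
  have iZ: "integrable M (\<lambda>\<omega>. indicator A \<omega> * (?b \<omega> * Z \<omega>))"
    using Z01 by (intro integrable_const_bound[of _ 1] AE_I2) (auto simp: indicator_def)
  have "(\<integral>\<omega>. e \<omega> * (indicator A \<omega> * ?b \<omega>) \<partial>M) = (\<integral>\<omega>. (indicator A \<omega> * e \<omega>) * ?b \<omega> \<partial>M)"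
    by (simp add: mult_ac)
  also have "\<dots> = (\<integral>\<omega>. (indicator A \<omega> * e \<omega>) * real_cond_exp M F ?b \<omega> \<partial>M)"
    by (rule real_cond_exp_intg(2)[symmetric]) (use ib in auto)
  also have "\<dots> = (\<integral>\<omega>. indicator A \<omega> * real_cond_exp M F (\<lambda>\<omega>. ?b \<omega> * Z \<omega>) \<omega> \<partial>M)"
    by (rule integral_cong_AE) (use prod in \<open>auto elim!: eventually_mono simp: mult.assoc\<close>)
  also have "\<dots> = (\<integral>\<omega>. indicator A \<omega> * (?b \<omega> * Z \<omega>) \<partial>M)"
    by (rule real_cond_exp_intg(2)) (use iZ in auto)
  finally show ?thesis
    by (simp add: mult_ac)
qed

text \<open>This turns weighted integrals into values of an image measure, where uniqueness theorems
  for measures apply. The weight may have any finite total mass, as is needed for \<open>e\<close>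
  and \<open>Z\<close> before division by \<open>p\<close>.\<close>

lemma emeasure_distr_density_eq_integral:
  fixes W :: "'w \<Rightarrow> real"
  assumes W: "integrable M W" and W0: "\<forall>\<omega>\<in>space M. 0 \<le> W \<omega>"
    and D[measurable]: "D \<in> measurable M N" and B[measurable]: "B \<in> sets N"
  shows "emeasure (distr (density M (\<lambda>\<omega>. ennreal (W \<omega>))) N D) B =
         ennreal (\<integral>\<omega>. W \<omega> * indicator B (D \<omega>) \<partial>M)"
proof -
  have [measurable]: "W \<in> borel_measurable M"
    using W by simp
  have "emeasure (distr (density M (\<lambda>\<omega>. ennreal (W \<omega>))) N D) B =
      (\<integral>\<^sup>+\<omega>. ennreal (W \<omega>) * indicator (D -` B \<inter> space M) \<omega> \<partial>M)"
    by (simp add: emeasure_distr emeasure_density)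
  also have "\<dots> = (\<integral>\<^sup>+\<omega>. ennreal (W \<omega> * indicator B (D \<omega>)) \<partial>M)"
    by (intro nn_integral_cong) (auto simp: indicator_def)
  also have "\<dots> = ennreal (\<integral>\<omega>. W \<omega> * indicator B (D \<omega>) \<partial>M)"
  proof (rule nn_integral_eq_integral)
    show "integrable M (\<lambda>\<omega>. W \<omega> * indicator B (D \<omega>))"
      by (rule Bochner_Integration.integrable_bound[OF W]) (auto simp: indicator_def)
    show "AE \<omega> in M. 0 \<le> W \<omega> * indicator B (D \<omega>)"
      using W0 by (auto simp: indicator_def)
  qed
  finally show ?thesis .
qed

text \<open>Both integrals are values at \<open>C\<close> of finite measures, the images under
  \<open>D\<close> of the densities \<open>V\<close> and \<open>U\<close>. Measurable rectangles
  form an intersection-stable generator of the product sigma-algebra, so agreement on them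
  suffices.\<close>

lemma integral_indicator_eq_of_rectangles:
  fixes V U :: "'w \<Rightarrow> real"
  assumes V: "integrable M V" "\<forall>\<omega>\<in>space M. 0 \<le> V \<omega>"
    and U: "integrable M U" "\<forall>\<omega>\<in>space M. 0 \<le> U \<omega>"
    and D: "D \<in> measurable M (N1 \<Otimes>\<^sub>M N2)"
    and rect: "\<And>A B. A \<in> sets N1 \<Longrightarrow> B \<in> sets N2 \<Longrightarrow>
      (\<integral>\<omega>. V \<omega> * indicator (A \<times> B) (D \<omega>) \<partial>M) = (\<integral>\<omega>. U \<omega> * indicator (A \<times> B) (D \<omega>) \<partial>M)"
    and C: "C \<in> sets (N1 \<Otimes>\<^sub>M N2)"
  shows "(\<integral>\<omega>. V \<omega> * indicator C (D \<omega>) \<partial>M) = (\<integral>\<omega>. U \<omega> * indicator C (D \<omega>) \<partial>M)"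
proof -
  let ?Q = "\<lambda>W. distr (density M (\<lambda>\<omega>. ennreal (W \<omega>))) (N1 \<Otimes>\<^sub>M N2) D"
  let ?E = "{A \<times> B | A B. A \<in> sets N1 \<and> B \<in> sets N2}"
  have "?Q V = ?Q U"
  proof (rule measure_eqI_generator_eq[where E = ?E and \<Omega> = "space N1 \<times> space N2"
        and A = "\<lambda>_. space N1 \<times> space N2"])
    show "Int_stable ?E"
      by (rule Int_stable_pair_measure_generator)
    show "?E \<subseteq> Pow (space N1 \<times> space N2)"
      by (rule pair_measure_closed)
    show "sets (?Q V) = sigma_sets (space N1 \<times> space N2) ?E"
      "sets (?Q U) = sigma_sets (space N1 \<times> space N2) ?E"
      by (simp_all add: sets_pair_measure)
    show "emeasure (?Q V) R = emeasure (?Q U) R" if R: "R \<in> ?E" for R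
    proof -
      from R obtain A B where "R = A \<times> B" "A \<in> sets N1" "B \<in> sets N2" by auto
      then show ?thesis
        using emeasure_distr_density_eq_integral[OF V D, of R]
          emeasure_distr_density_eq_integral[OF U D, of R] rect by auto
    qed
    \<comment> \<open>The whole space is itself a rectangle of finite mass, so a constant sequence
      serves as the exhaustion.\<close>
    show "emeasure (?Q V) (space N1 \<times> space N2) \<noteq> \<infinity>"
      using emeasure_distr_density_eq_integral[OF V D, of "space N1 \<times> space N2"] by auto
  qed auto
  then have "ennreal (\<integral>\<omega>. V \<omega> * indicator C (D \<omega>) \<partial>M) = ennreal (\<integral>\<omega>. U \<omega> * indicator C (D \<omega>) \<partial>M)"
    using emeasure_distr_density_eq_integral[OF V D C] emeasure_distr_density_eq_integral[OF U D C]
    by simp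
  moreover have "0 \<le> (\<integral>\<omega>. V \<omega> * indicator C (D \<omega>) \<partial>M)" "0 \<le> (\<integral>\<omega>. U \<omega> * indicator C (D \<omega>) \<partial>M)"
    using V(2) U(2) by (auto intro!: integral_nonneg_AE simp: indicator_def)
  ultimately show ?thesis
    by simp
qed

text \<open>This covers both arms: \<open>U\<close>, \<open>V\<close>, \<open>q\<close> become
  \<open>Z\<close>, \<open>e\<close>, \<open>p\<close> for treatment and \<open>1 - Z\<close>,
  \<open>1 - e\<close>, \<open>1 - p\<close> for control. Weighting by \<open>U\<close> keeps only
  the event on which \<open>D_E\<close> equals \<open>D\<close>, and independence splits off the
  factor \<open>q\<close>, which the normalisation cancels.\<close>

lemma weighted_law_eq_distr:
  fixes U V :: "'w \<Rightarrow> real"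
  assumes "prob_space M"
    and U: "U \<in> borel_measurable M" and U01: "\<forall>\<omega>\<in>space M. U \<omega> \<in> {0, 1}"
    and q: "measure M {\<omega> \<in> space M. U \<omega> = 1} = q" and "0 < q"
    and V: "V \<in> borel_measurable M" and V01: "\<forall>\<omega>\<in>space M. V \<omega> \<in> {0..1}"
    and D: "D \<in> measurable M S" and D_E: "D_E \<in> measurable M S"
    and D_E_eq: "\<And>\<omega>. \<omega> \<in> space M \<Longrightarrow> U \<omega> = 1 \<Longrightarrow> D_E \<omega> = D \<omega>"
    and indep: "\<And>C. C \<in> sets S \<Longrightarrow>
      measure M {\<omega> \<in> space M. U \<omega> = 1 \<and> D \<omega> \<in> C} = q * measure M {\<omega> \<in> space M. D \<omega> \<in> C}"
    and VU: "\<And>C. C \<in> sets S \<Longrightarrow>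
      (\<integral>\<omega>. V \<omega> * indicator C (D_E \<omega>) \<partial>M) = (\<integral>\<omega>. U \<omega> * indicator C (D_E \<omega>) \<partial>M)"
  shows "is_weight M (\<lambda>\<omega>. V \<omega> / q) \<and> weighted_law M S (\<lambda>\<omega>. V \<omega> / q) D_E = distr M S D"
proof
  interpret prob_space M by fact
  note [measurable] = U V D D_E
  have mass: "(\<integral>\<omega>. V \<omega> / q * indicator C (D_E \<omega>) \<partial>M) = measure M {\<omega> \<in> space M. D \<omega> \<in> C}"
    if C[measurable]: "C \<in> sets S" for C
  proof -
    have "(\<integral>\<omega>. V \<omega> * indicator C (D_E \<omega>) \<partial>M) = (\<integral>\<omega>. U \<omega> * indicator C (D_E \<omega>) \<partial>M)"
      using VU C .
    also have "\<dots> = (\<integral>\<omega>. indicator {\<omega> \<in> space M. U \<omega> = 1 \<and> D \<omega> \<in> C} \<omega> \<partial>M)"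
      by (rule Bochner_Integration.integral_cong)
        (use U01 D_E_eq in \<open>auto simp: indicator_def\<close>)
    also have "\<dots> = q * measure M {\<omega> \<in> space M. D \<omega> \<in> C}"
      using indep[OF C] by simp
    finally show ?thesis
      using \<open>0 < q\<close> by simp
  qed
  \<comment> \<open>Normalisation is the case \<open>C = space S\<close> of \<open>mass\<close>. It
    has to come first, since \<open>emeasure_weighted_law\<close> applies to weights only.\<close>
  have "(\<integral>\<omega>. V \<omega> / q \<partial>M) = (\<integral>\<omega>. V \<omega> / q * indicator (space S) (D_E \<omega>) \<partial>M)"
    by (rule Bochner_Integration.integral_cong)
      (auto simp: indicator_def dest: measurable_space[OF D_E])
  also have "\<dots> = measure M {\<omega> \<in> space M. D \<omega> \<in> space S}"
    by (rule mass) simp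
  also have "{\<omega> \<in> space M. D \<omega> \<in> space S} = space M"
    using measurable_space[OF D] by auto
  finally have one: "(\<integral>\<omega>. V \<omega> / q \<partial>M) = 1"
    by (simp add: prob_space)
  show W: "is_weight M (\<lambda>\<omega>. V \<omega> / q)"
    using one V01 \<open>0 < q\<close> by (auto simp: is_weight_def)
  show "weighted_law M S (\<lambda>\<omega>. V \<omega> / q) D_E = distr M S D"
  proof (rule measure_eqI)
    show sets_eq: "sets (weighted_law M S (\<lambda>\<omega>. V \<omega> / q) D_E) = sets (distr M S D)"
      by (simp add: weighted_law_def sets.sets_measure_of_eq)
    fix C assume "C \<in> sets (weighted_law M S (\<lambda>\<omega>. V \<omega> / q) D_E)"
    then have C: "C \<in> sets S"
      using sets_eq by simp
    have "D -` C \<inter> space M = {\<omega> \<in> space M. D \<omega> \<in> C}" by auto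
    then show "emeasure (weighted_law M S (\<lambda>\<omega>. V \<omega> / q) D_E) C = emeasure (distr M S D) C"
      using emeasure_weighted_law[OF W D_E C] mass[OF C] C
      by (simp add: emeasure_distr[OF D] emeasure_eq_measure)
  qed
qed

theorem lemma1:
  fixes M :: "'w measure"
    and X :: "(real ^ 'd) set" and Y :: "(real ^ 'm) set"
    and S :: "((real ^ 'd) \<times> (real ^ 'm)) measure"
    and p :: real
    and D_C D_T D_E :: "'w \<Rightarrow> (real ^ 'd) \<times> (real ^ 'm)"
    and X_E :: "'w \<Rightarrow> real ^ 'd" and Y_E :: "'w \<Rightarrow> real ^ 'm"
    and Z e W_T W_C :: "'w \<Rightarrow> real"
  assumes "prob_space M"
    and "X \<in> sets borel" and "Y \<in> sets borel"
    and "S = restrict_space borel (X \<times> Y)"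
    and "0 < p" and "p < 1"
    and "D_C \<in> measurable M S" and "D_T \<in> measurable M S"
    and "Z \<in> borel_measurable M" and "\<forall>\<omega>\<in>space M. Z \<omega> \<in> {0, 1}"
    and "measure M {\<omega> \<in> space M. Z \<omega> = 1} = p"
    and "prob_space.indep_set M (sets (generated_by M borel Z))
           (sets (generated_by M (S \<Otimes>\<^sub>M S) (\<lambda>\<omega>. (D_C \<omega>, D_T \<omega>))))"
    and "D_E = (\<lambda>\<omega>. Z \<omega> *\<^sub>R D_T \<omega> + (1 - Z \<omega>) *\<^sub>R D_C \<omega>)"
    and "X_E = (\<lambda>\<omega>. fst (D_E \<omega>))" and "Y_E = (\<lambda>\<omega>. snd (D_E \<omega>))"
    and "cond_indep_var M (generated_by M borel X_E) borel Y_E borel Z"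
    and "cond_exp_version M (generated_by M borel X_E) Z e"
    and "\<forall>\<omega>\<in>space M. e \<omega> \<in> {0..1}"
    and "W_T = (\<lambda>\<omega>. e \<omega> / p)" and "W_C = (\<lambda>\<omega>. (1 - e \<omega>) / (1 - p))"
  shows "is_weight M W_T \<and> weighted_law M S W_T D_E = distr M S D_T \<and>
         is_weight M W_C \<and> weighted_law M S W_C D_E = distr M S D_C"
proof -
  note D_E_def = assms(13) and X_E_def = assms(14) and Y_E_def = assms(15)
  note Z01 = assms(10) and ci = assms(16) and e = assms(17) and e01 = assms(18)
  interpret prob_space M by fact
  note [measurable] = assms(7-9)
  let ?F = "generated_by M borel X_E"
  \<comment> \<open>As \<open>X \<times> Y\<close> is Borel, the measurable sets of the subspace are
    Borel in the ambient space, where the rectangle argument takes place.\<close>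
  have S_borel: "sets S \<subseteq> sets (borel :: ((real ^ 'd) \<times> (real ^ 'm)) measure)"
    unfolding assms(4) using assms(2,3) by (auto simp: sets_restrict_space intro: borel_Times)
  have D_E[measurable]: "D_E \<in> measurable M S"
  proof -
    \<comment> \<open>A linear combination of points of \<open>X \<times> Y\<close> may leave that
      set; the case distinction shows that \<open>D_E\<close> stays in it.\<close>
    have "(\<lambda>\<omega>. if Z \<omega> = 1 then D_T \<omega> else D_C \<omega>) \<in> measurable M S"
      by measurable
    moreover have "D_E \<omega> = (if Z \<omega> = 1 then D_T \<omega> else D_C \<omega>)" if "\<omega> \<in> space M" for \<omega>
      using Z01 that by (auto simp: D_E_def)
    ultimately show ?thesis
      by (simp cong: measurable_cong)
  qed
  have arms: "Z \<omega> = 1 \<Longrightarrow> D_E \<omega> = D_T \<omega>" "Z \<omega> = 0 \<Longrightarrow> D_E \<omega> = D_C \<omega>" for \<omega>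
    by (simp_all add: D_E_def)
  have D_E_prod: "D_E \<in> measurable M (borel \<Otimes>\<^sub>M borel)"
    using D_E unfolding assms(4) by (simp add: measurable_restrict_space2_iff borel_prod)
  have eM[measurable]: "e \<in> borel_measurable M"
    using e ci measurable_from_subalg by (auto simp: cond_exp_version_def cond_indep_var_def)
  have int_e: "integrable M e"
    using e01 by (intro integrable_const_bound[of _ 1] AE_I2) auto
  have int_Z: "integrable M Z"
    using Z01 by (intro integrable_const_bound[of _ 1] AE_I2) auto
  have eZ: "(\<integral>\<omega>. e \<omega> * indicator C (D_E \<omega>) \<partial>M) = (\<integral>\<omega>. Z \<omega> * indicator C (D_E \<omega>) \<partial>M)"
    if C: "C \<in> sets S" for C
  proof (rule integral_indicator_eq_of_rectangles[OF int_e _ int_Z _ D_E_prod])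
    show "\<forall>\<omega>\<in>space M. 0 \<le> e \<omega>" "\<forall>\<omega>\<in>space M. 0 \<le> Z \<omega>"
      using e01 Z01 by force+
    show "C \<in> sets (borel \<Otimes>\<^sub>M borel)"
      unfolding borel_prod using C S_borel by (rule rev_subsetD)
    fix A :: "(real ^ 'd) set" and B :: "(real ^ 'm) set"
    assume A: "A \<in> sets borel" and B: "B \<in> sets borel"
    let ?A = "X_E -` A \<inter> space M"
    have AF: "?A \<in> sets ?F"
      using A by (auto simp: sets_vimage_algebra)
    \<comment> \<open>The first side of the rectangle gives an event of the sigma-algebra generated
      by \<open>X_E\<close>, the second an event of \<open>Y_E\<close>.\<close>
    have ind: "(indicator (A \<times> B) (D_E \<omega>) :: real) = indicator ?A \<omega> * indicator B (Y_E \<omega>)"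
      if "\<omega> \<in> space M" for \<omega>
      using that by (auto simp: X_E_def Y_E_def indicator_def mem_Times_iff)
    show "(\<integral>\<omega>. e \<omega> * indicator (A \<times> B) (D_E \<omega>) \<partial>M) = (\<integral>\<omega>. Z \<omega> * indicator (A \<times> B) (D_E \<omega>) \<partial>M)"
      using integral_cond_exp_version_cond_indep[OF assms(1) Z01 ci e e01 AF B]
      by (simp add: ind cong: Bochner_Integration.integral_cong)
  qed
  \<comment> \<open>The value \<open>z\<close> is left free because the treatment arm uses 1 and the
    control arm uses 0.\<close>
  have indep: "prob {\<omega> \<in> space M. Z \<omega> = z \<and> (D_C \<omega>, D_T \<omega>) \<in> R} =
      prob {\<omega> \<in> space M. Z \<omega> = z} * prob {\<omega> \<in> space M. (D_C \<omega>, D_T \<omega>) \<in> R}"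
    if R: "R \<in> sets (S \<Otimes>\<^sub>M S)" for z R
  proof -
    let ?a = "Z -` {z} \<inter> space M" and ?b = "(\<lambda>\<omega>. (D_C \<omega>, D_T \<omega>)) -` R \<inter> space M"
    have "?a \<in> sets (generated_by M borel Z)"
      by (rule in_vimage_algebra) simp
    moreover have "?b \<in> sets (generated_by M (S \<Otimes>\<^sub>M S) (\<lambda>\<omega>. (D_C \<omega>, D_T \<omega>)))"
      by (rule in_vimage_algebra) (rule R)
    ultimately have "prob (?a \<inter> ?b) = prob ?a * prob ?b"
      using indep_setD[OF assms(12)] by blast
    moreover have "?a \<inter> ?b = {\<omega> \<in> space M. Z \<omega> = z \<and> (D_C \<omega>, D_T \<omega>) \<in> R}"
      "?a = {\<omega> \<in> space M. Z \<omega> = z}" "?b = {\<omega> \<in> space M. (D_C \<omega>, D_T \<omega>) \<in> R}" by auto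
    ultimately show ?thesis by simp
  qed
  have Z0: "prob {\<omega> \<in> space M. Z \<omega> = 0} = 1 - p"
  proof -
    have "{\<omega> \<in> space M. Z \<omega> = 0} = space M - {\<omega> \<in> space M. Z \<omega> = 1}"
      using Z01 by auto
    then show ?thesis
      using prob_compl[of "{\<omega> \<in> space M. Z \<omega> = 1}"] assms(11) by simp
  qed
  have T: "is_weight M (\<lambda>\<omega>. e \<omega> / p) \<and> weighted_law M S (\<lambda>\<omega>. e \<omega> / p) D_E = distr M S D_T"
  proof (rule weighted_law_eq_distr[where U = Z])
    fix C assume C: "C \<in> sets S"
    \<comment> \<open>Taking the full space in the control coordinate reduces independence of the
      pair to that of \<open>D_T\<close>.\<close>
    have "prob {\<omega> \<in> space M. Z \<omega> = 1 \<and> (D_C \<omega>, D_T \<omega>) \<in> space S \<times> C} =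
        p * prob {\<omega> \<in> space M. (D_C \<omega>, D_T \<omega>) \<in> space S \<times> C}"
      using indep[of "space S \<times> C" 1] C assms(11) by simp
    then show "prob {\<omega> \<in> space M. Z \<omega> = 1 \<and> D_T \<omega> \<in> C} = p * prob {\<omega> \<in> space M. D_T \<omega> \<in> C}"
      using measurable_space[OF assms(7)] by (simp cong: conj_cong)
  qed (use assms(1,5,11) Z01 e01 eZ in \<open>auto simp: arms\<close>)
  have C: "is_weight M (\<lambda>\<omega>. (1 - e \<omega>) / (1 - p)) \<and>
      weighted_law M S (\<lambda>\<omega>. (1 - e \<omega>) / (1 - p)) D_E = distr M S D_C"
  proof (rule weighted_law_eq_distr[where U = "\<lambda>\<omega>. 1 - Z \<omega>"])
    fix C assume C[measurable]: "C \<in> sets S"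
    have "prob {\<omega> \<in> space M. Z \<omega> = 0 \<and> (D_C \<omega>, D_T \<omega>) \<in> C \<times> space S} =
        (1 - p) * prob {\<omega> \<in> space M. (D_C \<omega>, D_T \<omega>) \<in> C \<times> space S}"
      using indep[of "C \<times> space S" 0] C Z0 by simp
    then show "prob {\<omega> \<in> space M. 1 - Z \<omega> = 1 \<and> D_C \<omega> \<in> C} = (1 - p) * prob {\<omega> \<in> space M. D_C \<omega> \<in> C}"
      using measurable_space[OF assms(8)] by (simp cong: conj_cong)
    have i: "integrable M (\<lambda>\<omega>. indicator C (D_E \<omega>) :: real)"
      "integrable M (\<lambda>\<omega>. e \<omega> * indicator C (D_E \<omega>))"
      "integrable M (\<lambda>\<omega>. Z \<omega> * indicator C (D_E \<omega>))"
      using e01 Z01 by (auto intro!: integrable_const_bound[of _ 1] AE_I2 simp: indicator_def)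
    \<comment> \<open>By linearity, subtracting both sides of \<open>eZ\<close> from the integral of
      the indicator gives the complementary identity.\<close>
    show "(\<integral>\<omega>. (1 - e \<omega>) * indicator C (D_E \<omega>) \<partial>M) = (\<integral>\<omega>. (1 - Z \<omega>) * indicator C (D_E \<omega>) \<partial>M)"
      using eZ[OF C] i by (simp add: left_diff_distrib)
  qed (use assms(1,6) Z01 Z0 e01 in \<open>auto simp: arms\<close>)
  show ?thesis
    using T C unfolding assms(19,20) by blast
qed

end
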